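(* Let $k\ge 1$ and $n\ge 2$ be integers. Then \[ \gamma_{[k]R}(C_{9}\Box P_n) \le 2n(k+1) + 2k. \]
   Context: All graphs are finite and simple. For a vertex $v$ of a graph $G$, $N(v)$ denotes its open neighborhood and $N[v]=N(v)\cup\{v\}$ its closed neighborhood. For $f:V(G)\to\mathbb{N}_0$ and $S\subseteq V(G)$ write $f(S)=\sum_{u\in S}f(u)$. For a positive integer $k$, a $[k]$-Roman dominating function of $G$ is a function $f:V(G)\to\{0,1,\dots,k+1\}$ such that every vertex $v$ with $f(v)<k$ satisfies $f(N[v])\ge k+|AN(v)|$, where $AN(v)=\{u\in N(v): f(u)>0\}$. The $[k]$-Roman domination number $\gamma_{[k]R}(G)$ is the minimum of $f(V(G))$ over all $[k]$-Roman dominating functions $f$ of $G$. $C_m\Box P_n$ denotes the Cartesian product of the cycle $C_m$ ($m\ge3$) and the path $P_n$ on $n$ vertices: its vertices are pairs $(i,j)$ with $i\in\{0,\dots,m-1\}$, $j\in\{0,\dots,n-1\}$, and $(i,j)$ is adjacent to $(i',j')$ iff either $j=j'$ and $i-i'\equiv\pm1\pmod m$, or $i=i'$ and $|j-j'|=1$. *)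

theory Defs
  imports "HOL-Number_Theory.Cong"
begin

text \<open>A graph is given by its vertex set and its adjacency relation.\<close>

definition simple_graph :: "'a set \<Rightarrow> ('a \<Rightarrow> 'a \<Rightarrow> bool) \<Rightarrow> bool" where
  "simple_graph V adj \<longleftrightarrow>
     finite V \<and>
     (\<forall>u v. adj u v \<longrightarrow> u \<in> V \<and> v \<in> V \<and> u \<noteq> v \<and> adj v u)"

definition open_nbhd :: "'a set \<Rightarrow> ('a \<Rightarrow> 'a \<Rightarrow> bool) \<Rightarrow> 'a \<Rightarrow> 'a set" where
  "open_nbhd V adj v = {u \<in> V. adj v u}"

definition closed_nbhd :: "'a set \<Rightarrow> ('a \<Rightarrow> 'a \<Rightarrow> bool) \<Rightarrow> 'a \<Rightarrow> 'a set" where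
  "closed_nbhd V adj v = insert v (open_nbhd V adj v)"

definition active_nbhd ::
    "'a set \<Rightarrow> ('a \<Rightarrow> 'a \<Rightarrow> bool) \<Rightarrow> ('a \<Rightarrow> nat) \<Rightarrow> 'a \<Rightarrow> 'a set" where
  "active_nbhd V adj f v = {u \<in> open_nbhd V adj v. f u > 0}"

text \<open>Only the values of \<open>f\<close> on \<open>V\<close> matter.\<close>

definition roman_dominating ::
    "nat \<Rightarrow> 'a set \<Rightarrow> ('a \<Rightarrow> 'a \<Rightarrow> bool) \<Rightarrow> ('a \<Rightarrow> nat) \<Rightarrow> bool" where
  "roman_dominating k V adj f \<longleftrightarrow>
     (\<forall>v\<in>V. f v \<le> k + 1) \<and>
     (\<forall>v\<in>V. f v < k \<longrightarrow>
        sum f (closed_nbhd V adj v) \<ge> k + card (active_nbhd V adj f v))"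

definition roman_domination_number ::
    "nat \<Rightarrow> 'a set \<Rightarrow> ('a \<Rightarrow> 'a \<Rightarrow> bool) \<Rightarrow> nat" where
  "roman_domination_number k V adj =
     (LEAST w. \<exists>f. roman_dominating k V adj f \<and> sum f V = w)"

text \<open>The minimum is attained, since the constant function \<open>k + 1\<close> is admissible.\<close>

lemma roman_dominating_const: "roman_dominating k V adj (\<lambda>_. k + 1)"
  by (simp add: roman_dominating_def)

lemma roman_domination_number_attained:
  "\<exists>f. roman_dominating k V adj f \<and> sum f V = roman_domination_number k V adj"
  unfolding roman_domination_number_def
  by (rule LeastI_ex) (use roman_dominating_const in blast)

lemma roman_domination_number_le:
  "roman_dominating k V adj f \<Longrightarrow> roman_domination_number k V adj \<le> sum f V"
  unfolding roman_domination_number_def by (rule Least_le) blast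

text \<open>The Cartesian product of the cycle on \<open>m\<close> vertices and the path on \<open>n\<close> vertices;
  meaningful for \<open>m \<ge> 3\<close>. Differences are taken in the integers to avoid truncation.\<close>

definition cycle_path_verts :: "nat \<Rightarrow> nat \<Rightarrow> (nat \<times> nat) set" where
  "cycle_path_verts m n = {0..<m} \<times> {0..<n}"

definition cycle_path_adj :: "nat \<Rightarrow> nat \<Rightarrow> nat \<times> nat \<Rightarrow> nat \<times> nat \<Rightarrow> bool" where
  "cycle_path_adj m n = (\<lambda>(i, j) (i', j').
     (i, j) \<in> cycle_path_verts m n \<and> (i', j') \<in> cycle_path_verts m n \<and>
     (j = j' \<and> ([int i - int i' = 1] (mod int m) \<or> [int i - int i' = - 1] (mod int m)) \<or>
      i = i' \<and> \<bar>int j - int j'\<bar> = 1))"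

lemma simple_graph_cycle_path:
  assumes "m \<ge> 3"
  shows "simple_graph (cycle_path_verts m n) (cycle_path_adj m n)"
proof -
  have sym: "[b - a = - c] (mod int m)" if "[a - b = c] (mod int m)" for a b c :: int
    using that cong_minus_minus_iff[of "a - b" c "int m"] by simp
  have irrefl: "\<not> [0 = 1] (mod int m)" "\<not> [0 = - 1] (mod int m)"
    using assms by (auto simp: cong_iff_dvd_diff)
  show ?thesis
    unfolding simple_graph_def
    using irrefl by (auto simp: cycle_path_verts_def cycle_path_adj_def dest: sym)
qed

end

theory Submission
  imports Defs
begin

text \<open>Give weight \<open>k + 1\<close> to the two vertices \<open>2 j\<close> and \<open>2 j + 4\<close> (modulo 9) of each column \<open>j\<close>.
  Relative to the offset \<open>2 j\<close>, they dominate all of column \<open>j\<close> except the positions 2, 6, 7;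
  the next column covers 2 and 6, the previous one covers 2 and 7. Hence only position 7 of the
  first column and position 6 of the last one stay undominated, and they receive weight \<open>k\<close>.\<close>

text \<open>A vertex of value below \<open>k\<close> lies outside \<open>D\<close> and
  \<open>U\<close>, so it has a neighbor in \<open>D\<close>. That neighbor contributes
  \<open>k + 1\<close> and each other active neighbor at least 1, which already gives
  \<open>k\<close> plus the number of active neighbors.\<close>

lemma roman_dominating_of_partial_dominating_set:
  assumes "finite V" "k \<ge> 1"
    and dom: "\<And>v. v \<in> V \<Longrightarrow> v \<notin> D \<Longrightarrow> v \<notin> U \<Longrightarrow> \<exists>u \<in> V \<inter> D. adj v u"
  shows "roman_dominating k V adj (\<lambda>v. if v \<in> D then k + 1 else if v \<in> U then k else 0)"
    (is "roman_dominating k V adj ?f")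
  unfolding roman_dominating_def
proof (intro conjI ballI impI)
  fix v assume "v \<in> V"
  show "?f v \<le> k + 1" by simp
next
  fix v assume v: "v \<in> V" "?f v < k"
  let ?A = "active_nbhd V adj ?f v"
  obtain u where u: "u \<in> V" "u \<in> D" "adj v u"
    using dom[of v] v by (auto split: if_splits)
  then have uA: "u \<in> ?A" by (simp add: active_nbhd_def open_nbhd_def)
  have fin: "finite (closed_nbhd V adj v)" "finite ?A"
    using \<open>finite V\<close> by (simp_all add: closed_nbhd_def active_nbhd_def open_nbhd_def)
  have "card (?A - {u}) = (\<Sum>w\<in>?A - {u}. 1)" by simp
  also have "\<dots> \<le> sum ?f (?A - {u})"
    by (rule sum_mono) (simp add: active_nbhd_def split: if_splits)
  finally have "k + 1 + card (?A - {u}) \<le> sum ?f ?A"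
    using sum.remove[OF fin(2) uA, of ?f] u(2) by simp
  moreover have "card ?A = Suc (card (?A - {u}))"
    by (rule card.remove[OF fin(2) uA])
  moreover have "sum ?f ?A \<le> sum ?f (closed_nbhd V adj v)"
    by (rule sum_mono2[OF fin(1)]) (auto simp: active_nbhd_def closed_nbhd_def)
  ultimately show "k + card ?A \<le> sum ?f (closed_nbhd V adj v)" by linarith
qed

lemma roman_domination_number_le_of_partial_dominating_set:
  assumes "finite V" "k \<ge> 1" "finite D" "finite U"
    and "\<And>v. v \<in> V \<Longrightarrow> v \<notin> D \<Longrightarrow> v \<notin> U \<Longrightarrow> \<exists>u \<in> V \<inter> D. adj v u"
  shows "roman_domination_number k V adj \<le> card D * (k + 1) + card U * k"
proof -
  let ?f = "\<lambda>v. if v \<in> D then k + 1 else if v \<in> U then k else 0"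
  \<comment> \<open>The two contributions are split; this is only an inequality, since a vertex in
    both \<open>D\<close> and \<open>U\<close> is counted twice on the right.\<close>
  have "sum ?f V \<le> (\<Sum>v\<in>V. (if v \<in> D then k + 1 else 0) + (if v \<in> U then k else 0))"
    by (rule sum_mono) simp
  also have "\<dots> = card (V \<inter> D) * (k + 1) + card (V \<inter> U) * k"
    using \<open>finite V\<close> by (simp only: sum.distrib sum.inter_restrict[symmetric]) simp
  also have "\<dots> \<le> card D * (k + 1) + card U * k"
    using assms by (intro add_mono mult_right_mono card_mono) auto
  finally have weight: "sum ?f V \<le> card D * (k + 1) + card U * k" .
  have "roman_dominating k V adj ?f"
    by (rule roman_dominating_of_partial_dominating_set) (fact assms)+
  from roman_domination_number_le[OF this] weight show ?thesis by (rule order_trans)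
qed

text \<open>Position \<open>r\<close> of column \<open>j\<close> is counted from the offset
  \<open>2 * j\<close>, so the chosen vertices become positions 0 and 4 in every column. Leaving
  \<open>r\<close> unreduced allows steps such as \<open>r + 2\<close> across the
  wrap-around.\<close>

definition skew :: "nat \<times> nat \<Rightarrow> nat \<times> nat" where
  "skew = (\<lambda>(r, j). ((r + 2 * j) mod 9, j))"

lemma skew_in_verts [simp]: "skew (r, j) \<in> cycle_path_verts 9 n \<longleftrightarrow> j < n"
  by (simp add: skew_def cycle_path_verts_def)

lemma skew_surj:
  assumes "(i, j) \<in> cycle_path_verts 9 n"
  obtains r where "r < 9" "(i, j) = skew (r, j)"
proof
  \<comment> \<open>Since 7 is -2 modulo 9, adding \<open>7 * j\<close> removes the offset without
    subtraction in the naturals.\<close>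
  show "(i + 7 * j) mod 9 < 9" by simp
  have "((i + 7 * j) mod 9 + 2 * j) mod 9 = (i + 7 * j + 2 * j) mod 9"
    by (rule mod_add_left_eq)
  also have "\<dots> = (i + j * 9) mod 9" by simp
  also have "\<dots> = i"
    using assms by (simp only: mod_mult_self1) (simp add: cycle_path_verts_def)
  finally show "(i, j) = skew ((i + 7 * j) mod 9, j)"
    by (simp only: skew_def prod.case)
qed

lemma skew_adj_Suc:
  assumes "j < n"
  shows "cycle_path_adj 9 n (skew (r, j)) (skew (Suc r, j))"
    and "cycle_path_adj 9 n (skew (Suc r, j)) (skew (r, j))"
proof -
  define a where "a = r + 2 * j"
  have "int (Suc a mod 9) = (int a + 1) mod 9" "int (a mod 9) = int a mod 9"
    by (simp_all add: zmod_int add.commute)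
  then have "[int (Suc a mod 9) - int (a mod 9) = 1] (mod 9)"
    "[int (a mod 9) - int (Suc a mod 9) = - 1] (mod 9)"
    by (simp_all add: cong_def mod_simps)
  then show "cycle_path_adj 9 n (skew (r, j)) (skew (Suc r, j))"
    and "cycle_path_adj 9 n (skew (Suc r, j)) (skew (r, j))"
    using assms by (simp_all add: cycle_path_adj_def cycle_path_verts_def skew_def a_def)
qed

lemma skew_add_9: "skew (r + 9, j) = skew (r, j)"
  using mod_add_self2[of "r + 2 * j" 9] by (simp add: skew_def add_ac)

text \<open>The offset grows by 2 per column, so a fixed row loses 2 in relative position when
  passing to the next column.\<close>

lemma skew_adj_next:
  assumes "Suc j < n"
  shows "cycle_path_adj 9 n (skew (r + 2, j)) (skew (r, Suc j))"
    and "cycle_path_adj 9 n (skew (r, Suc j)) (skew (r + 2, j))"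
  using assms by (simp_all add: cycle_path_adj_def cycle_path_verts_def skew_def)

lemma skew_dominated:
  assumes "j < n" "n \<ge> 2" "r < 9" "r \<noteq> 0" "r \<noteq> 4"
    and first: "\<not> (r = 7 \<and> j = 0)" and last: "\<not> (r = 6 \<and> j = n - 1)"
  shows "\<exists>s\<in>{0, 4}. \<exists>j'<n. cycle_path_adj 9 n (skew (r, j)) (skew (s, j'))"
proof -
  have witness: ?thesis
    if "s \<in> {0, 4}" "j' < n" "cycle_path_adj 9 n (skew (r, j)) (skew (s, j'))" for s j'
    using that by blast
  have up: "cycle_path_adj 9 n (skew (s + 2, j)) (skew (s, Suc j))" if "Suc j < n" for s
    using that by (rule skew_adj_next)
  have down: "cycle_path_adj 9 n (skew (s, j)) (skew (s + 2, j - 1))" if "j > 0" for s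
    using skew_adj_next(2)[of "j - 1" n s] that \<open>j < n\<close> by simp
  \<comment> \<open>Position 9 arises as 8 + 1 inside a column and as 7 + 2 in the previous column;
    both are position 0.\<close>
  have wrap: "skew (9, j') = skew (0, j')" for j'
    using skew_add_9[of 0 j'] by simp
  \<comment> \<open>Positions 1, 3, 5, 8 are dominated inside their column, 6 only from the next one
    and 7 only from the previous one. Position 2 is dominated from either side, and
    \<open>n \<ge> 2\<close> provides at least one adjacent column.\<close>
  consider "r = 1" | "r = 2" "Suc j < n" | "r = 2" "j > 0" | "r = 3" | "r = 5"
    | "r = 6" "Suc j < n" | "r = 7" "j > 0" | "r = 8"
  proof -
    have "r = 1 \<or> r = 2 \<or> r = 3 \<or> r = 5 \<or> r = 6 \<or> r = 7 \<or> r = 8"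
      using assms(3-5) by (auto simp: numeral_eq_Suc less_Suc_eq)
    moreover have "Suc j < n \<or> j > 0" using \<open>n \<ge> 2\<close> by linarith
    moreover have "j > 0" if "r = 7" using first that by simp
    moreover have "Suc j < n" if "r = 6"
    proof -
      have "j \<noteq> n - 1" using last that by simp
      then show ?thesis using \<open>j < n\<close> by linarith
    qed
    ultimately show ?thesis using that by blast
  qed
  then show ?thesis
  proof cases
    case 1
    show ?thesis by (rule witness[of 0 j]) (use skew_adj_Suc(2)[of j n 0] 1 \<open>j < n\<close> in simp_all)
  next
    case 2
    show ?thesis by (rule witness[of 0 "Suc j"]) (use up[of 0] 2 in \<open>simp_all add: numeral_2_eq_2\<close>)
  next
    case 3
    show ?thesis by (rule witness[of 4 "j - 1"]) (use down[of 2] 3 \<open>j < n\<close> in simp_all)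
  next
    case 4
    show ?thesis by (rule witness[of 4 j]) (use skew_adj_Suc(1)[of j n 3] 4 \<open>j < n\<close> in simp_all)
  next
    case 5
    show ?thesis by (rule witness[of 4 j]) (use skew_adj_Suc(2)[of j n 4] 5 \<open>j < n\<close> in simp_all)
  next
    case 6
    show ?thesis by (rule witness[of 4 "Suc j"]) (use up[of 4] 6 in simp_all)
  next
    case 7
    show ?thesis by (rule witness[of 0 "j - 1"]) (use down[of 7] wrap 7 \<open>j < n\<close> in simp_all)
  next
    case 8
    show ?thesis by (rule witness[of 0 j]) (use skew_adj_Suc(1)[of j n 8] wrap 8 \<open>j < n\<close> in simp_all)
  qed
qed

theorem theorem1:
  fixes k n :: nat
  assumes "k \<ge> 1" and "n \<ge> 2"
  shows "roman_domination_number k (cycle_path_verts 9 n) (cycle_path_adj 9 n)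
           \<le> 2 * n * (k + 1) + 2 * k"
proof -
  let ?V = "cycle_path_verts 9 n" and ?adj = "cycle_path_adj 9 n"
  define D where "D = skew ` ({0, 4} \<times> {0..<n})"
  define U where "U = {skew (7, 0), skew (6, n - 1)}"
  have fin: "finite ?V" "finite D" "finite U"
    by (simp_all add: cycle_path_verts_def D_def U_def)
  have "\<exists>u \<in> ?V \<inter> D. ?adj v u" if v: "v \<in> ?V" "v \<notin> D" "v \<notin> U" for v
  proof -
    obtain i j where ij: "v = (i, j)" by fastforce
    then obtain r where r: "r < 9" "v = skew (r, j)"
      using skew_surj v(1) by metis
    then have "j < n" using v(1) by simp
    \<comment> \<open>Each excluded case would place \<open>v\<close> in \<open>D\<close> or in
      \<open>U\<close>.\<close>
    then have "r \<noteq> 0" "r \<noteq> 4" "\<not> (r = 7 \<and> j = 0)" "\<not> (r = 6 \<and> j = n - 1)"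
      using v r by (auto simp: D_def U_def)
    then obtain s j' where "s \<in> {0, 4}" "j' < n" "?adj v (skew (s, j'))"
      using skew_dominated[OF \<open>j < n\<close> \<open>n \<ge> 2\<close> r(1)] r(2) by blast
    then show ?thesis by (intro bexI[of _ "skew (s, j')"]) (auto simp: D_def)
  qed
  from roman_domination_number_le_of_partial_dominating_set[OF fin(1) \<open>k \<ge> 1\<close> fin(2,3) this]
  have "roman_domination_number k ?V ?adj \<le> card D * (k + 1) + card U * k" .
  also have "\<dots> \<le> 2 * n * (k + 1) + 2 * k"
  proof (intro add_mono mult_right_mono)
    show "card D \<le> 2 * n"
      using card_image_le[of "{0, 4} \<times> {0..<n}" skew] by (simp add: D_def)
    show "card U \<le> 2"
      by (simp add: U_def card_insert_if)
  qed simp_all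
  finally show ?thesis .
qed

end
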